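(* There exist absolute constants $c,C\ge 1$ and an online scheduler $\texttt{ALG}$ for the serial-parallel scheduling problem that does not use cancelling, such that for every task arrival process $\mathcal{T}$, $$\mathrm{TRT}_{\texttt{ALG}}^{\mathcal{T}}\le C\cdot \mathrm{TRT}_{\texttt{OPT}}^{c\cdot\mathcal{T}};$$ that is, with $O(1)$ speed augmentation and without cancelling, $\texttt{ALG}$ is $O(1)$-competitive for mean response time.
   Context: Serial-parallel scheduling problem: $p$ identical processors ($p$ at least a sufficiently large constant). A task arrival process (TAP) is a finite set of tasks $\tau_i=(\sigma_i,\pi_i,t_i)$, $i=1,\dots,n$, with arrival time $t_i\ge0$, serial work $\sigma_i$ and parallel work $\pi_i$, $1\le\pi_i/\sigma_i\le p$. A task is performed either by its serial job (work $\sigma_i$, at most one processor at any instant) or by its parallel job (work $\pi_i$, any number of processors, rate equal to number of processors). Time is continuous; processors are allocated (fractionally via time sharing) among arrived unfinished jobs; a job completes when the integral of its allocated processors reaches its work. Before starting a task the scheduler irrevocably chooses an implementation (no cancelling/restarting with the other implementation); preemption is allowed. An online scheduler learns about a task only at its arrival. The total response time $\mathrm{TRT}^{\mathcal{T}}_{\texttt{ALG}}=\sum_i(f_i-t_i)$, where $f_i$ is the completion time of $\tau_i$; mean response time is $\mathrm{TRT}/n$. $\mathrm{TRT}^{\mathcal{T}}_{\texttt{OPT}}$ is the minimum total response time achievable by an offline schedule on $\mathcal{T}$. For $c>0$, $c\cdot\mathcal{T}$ is $\mathcal{T}$ with all serial and parallel works multiplied by $c$ (equivalently, $\texttt{ALG}$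 runs on processors $c$ times faster than $\texttt{OPT}$'s). *)

theory Defs
  imports "HOL-Analysis.Analysis"
begin

text \<open>A task is a triple (serial work, parallel work, arrival time).
  A task arrival process (TAP) is a finite list of tasks, listed in
  nondecreasing order of arrival time.\<close>

type_synonym task = "real \<times> real \<times> real"

definition sig :: "task \<Rightarrow> real" where "sig x = fst x"
definition par :: "task \<Rightarrow> real" where "par x = fst (snd x)"
definition arr :: "task \<Rightarrow> real" where "arr x = snd (snd x)"

definition valid_tap :: "nat \<Rightarrow> task list \<Rightarrow> bool" where
  "valid_tap p T \<longleftrightarrow>
     (\<forall>x\<in>set T. 0 < sig x \<and> sig x \<le> par x \<and> par x \<le> real p * sig x \<and> 0 \<le> arr x)
     \<and> sorted (map arr T)"

definition scale_tap :: "real \<Rightarrow> task list \<Rightarrow> task list" where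
  "scale_tap c T = map (\<lambda>x. (c * sig x, c * par x, arr x)) T"

text \<open>A schedule: for each task index i, the implementation choice
  (True = parallel job, False = serial job) and the (fractional) number of
  processors allocated to task i as a function of time.\<close>
type_synonym sched = "(nat \<Rightarrow> bool) \<times> (nat \<Rightarrow> real \<Rightarrow> real)"

definition choice :: "sched \<Rightarrow> nat \<Rightarrow> bool" where "choice S = fst S"
definition alloc :: "sched \<Rightarrow> nat \<Rightarrow> real \<Rightarrow> real" where "alloc S = snd S"

definition work :: "task list \<Rightarrow> sched \<Rightarrow> nat \<Rightarrow> real" where
  "work T S i = (if choice S i then par (T ! i) else sig (T ! i))"

definition cum :: "sched \<Rightarrow> nat \<Rightarrow> real \<Rightarrow> real \<Rightarrow> real" where
  "cum S i a x = (LINT s:{a..x}|lborel. alloc S i s)"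

definition completion :: "task list \<Rightarrow> sched \<Rightarrow> nat \<Rightarrow> real" where
  "completion T S i = Inf {x. arr (T ! i) \<le> x \<and> work T S i \<le> cum S i (arr (T ! i)) x}"

definition feasible :: "nat \<Rightarrow> task list \<Rightarrow> sched \<Rightarrow> bool" where
  "feasible p T S \<longleftrightarrow>
     (\<forall>i<length T.
        alloc S i \<in> borel_measurable lborel
      \<and> (\<forall>s. 0 \<le> alloc S i s)
      \<and> (\<forall>s. s < arr (T ! i) \<longrightarrow> alloc S i s = 0)
      \<and> (\<not> choice S i \<longrightarrow> (\<forall>s. alloc S i s \<le> 1))
      \<and> (\<exists>x. arr (T ! i) \<le> x \<and> work T S i \<le> cum S i (arr (T ! i)) x)
      \<and> (\<forall>s. completion T S i < s \<longrightarrow> alloc S i s = 0))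
   \<and> (\<forall>s. (\<Sum>i<length T. alloc S i s) \<le> real p)"

definition TRT :: "task list \<Rightarrow> sched \<Rightarrow> real" where
  "TRT T S = (\<Sum>i<length T. completion T S i - arr (T ! i))"

definition TRT_OPT :: "nat \<Rightarrow> task list \<Rightarrow> real" where
  "TRT_OPT p T = Inf {TRT T S | S. feasible p T S}"

definition online :: "nat \<Rightarrow> (task list \<Rightarrow> sched) \<Rightarrow> bool" where
  "online p ALG \<longleftrightarrow>
     (\<forall>T T' k t. valid_tap p T \<and> valid_tap p T' \<and> k \<le> length T \<and> k \<le> length T' \<and> take k T = take k T'
        \<and> (\<forall>i. k \<le> i \<and> i < length T \<longrightarrow> t < arr (T ! i))
        \<and> (\<forall>i. k \<le> i \<and> i < length T' \<longrightarrow> t < arr (T' ! i))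
      \<longrightarrow> (\<forall>i<k. (\<forall>s\<le>t. alloc (ALG T) i s = alloc (ALG T') i s)
                 \<and> (0 < cum (ALG T) i (arr (T ! i)) t \<longrightarrow> choice (ALG T) i = choice (ALG T') i)))"

definition online_scheduler :: "nat \<Rightarrow> (task list \<Rightarrow> sched) \<Rightarrow> bool" where
  "online_scheduler p ALG \<longleftrightarrow>
     online p ALG \<and> (\<forall>T. valid_tap p T \<longrightarrow> feasible p T (ALG T))"

end

theory Submission
  imports Defs
begin

text \<open>
  A virtual single machine of speed \<open>p / 4\<close> keeps a predicted completion time for every task.
  Running a task serially is modelled by paying its serial work as an extra penalty instead of by
  a rate limit.  An arriving task picks an implementation and an instant \<open>\<theta>\<close>; it is
  inserted at \<open>\<theta>\<close> and everything predicted to finish later is shifted by its length.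
  The pair is chosen to minimise the increase of virtual response time plus penalty.  Because
  this increase is minimal over all \<open>\<theta>\<close>, taking \<open>\<theta>\<close> to be any instant at which an
  optimal schedule serves the task shows that the increases form a feasible solution of the dual
  of a linear relaxation, with the number of virtually alive tasks as the price of machine time;
  hence their sum, which is the total virtual cost, is \<open>O(OPT)\<close>.

  A task is released to the real processors when it finishes virtually, with its own virtual cost
  as static priority (cheapest first).  The work of tasks arriving and virtually finishing inside
  a window is at most \<open>p / 4\<close> times its length, so, by induction on the priority, every task
  really finishes within four times its virtual cost.
\<close>

section \<open>Serving a single job\<close>

definition rate_fun :: "real \<Rightarrow> (real \<Rightarrow> real) \<Rightarrow> bool" where
  "rate_fun B f \<longleftrightarrow> f \<in> borel_measurable borel \<and> (\<forall>x. 0 \<le> f x \<and> f x \<le> B)"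

lemma rate_fun_set_integrable:
  assumes "rate_fun B f"
  shows "set_integrable lborel {a..b} f"
proof (rule set_integrable_bound)
  show "set_integrable lborel {a..b} (\<lambda>_. B)"
    by (auto simp: set_integrable_def emeasure_lborel_Icc_eq intro!: integrable_real_indicator)
  show "set_borel_measurable lborel {a..b} f"
    using assms by (auto simp: rate_fun_def set_borel_measurable_def)
  show "AE x in lborel. x \<in> {a..b} \<longrightarrow> norm (f x) \<le> norm B"
    using assms by (auto simp: rate_fun_def intro: order_trans[OF _ abs_ge_self])
qed

lemma rate_fun_integrable_on: "rate_fun B f \<Longrightarrow> f integrable_on {a..b}"
  by (rule set_borel_integral_eq_integral(1)[OF rate_fun_set_integrable])

lemma rate_fun_LINT: "rate_fun B f \<Longrightarrow> (LINT x:{a..b}|lborel. f x) = integral {a..b} f"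
  by (rule set_borel_integral_eq_integral(2)[OF rate_fun_set_integrable])

lemma rate_fun_integral_mono:
  assumes "rate_fun B f" "{a..b} \<subseteq> {a'..b'}"
  shows "integral {a..b} f \<le> integral {a'..b'} f"
  using assms by (intro integral_subset_le rate_fun_integrable_on) (auto simp: rate_fun_def)

lemma rate_fun_integral_nonneg: "rate_fun B f \<Longrightarrow> 0 \<le> integral {a..b} f"
  by (intro integral_nonneg rate_fun_integrable_on) (auto simp: rate_fun_def)

lemma rate_fun_integral_le:
  assumes "rate_fun B f" "a \<le> b"
  shows "integral {a..b} f \<le> B * (b - a)"
proof -
  have "integral {a..b} f \<le> integral {a..b} (\<lambda>_. B)"
    using assms by (intro integral_le rate_fun_integrable_on) (auto simp: rate_fun_def)
  then show ?thesis using assms(2) by (simp add: mult.commute)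
qed

lemma rate_fun_integral_combine:
  assumes "rate_fun B f" "a \<le> b" "b \<le> c"
  shows "integral {a..c} f = integral {a..b} f + integral {b..c} f"
  using Henstock_Kurzweil_Integration.integral_combine[OF assms(2,3) rate_fun_integrable_on[OF assms(1)]]
  by simp

lemma feasible_rate_fun:
  assumes "feasible p T S" "j < length T"
  shows "rate_fun p (alloc S j)"
proof -
  have nonneg: "0 \<le> alloc S i s" if "i < length T" for i s
    using assms that by (auto simp: feasible_def)
  have "alloc S j s \<le> real p" for s
  proof -
    have "alloc S j s \<le> (\<Sum>i<length T. alloc S i s)"
      using assms(2) nonneg by (intro member_le_sum) auto
    also have "\<dots> \<le> p" using assms(1) by (simp add: feasible_def)
    finally show ?thesis .
  qed
  then show ?thesis
    using assms nonneg by (simp add: feasible_def rate_fun_def)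
qed

text \<open>The stopping test integrates the offered rate \<open>m\<close>, not the rate actually
  served, so the definition needs no fixed point; the two integrals agree until the job is
  done.\<close>

definition serve :: "real \<Rightarrow> real \<Rightarrow> (real \<Rightarrow> real) \<Rightarrow> real \<Rightarrow> real" where
  "serve r W m s = (if r \<le> s \<and> integral {r..s} m < W then m s else 0)"

lemma rate_fun_serve:
  assumes "rate_fun B m"
  shows "rate_fun B (serve r W m)"
proof -
  have "mono (\<lambda>s. integral {r..s} m)"
    by (intro monoI rate_fun_integral_mono[OF assms]) auto
  then have [measurable]: "(\<lambda>s. integral {r..s} m) \<in> borel_measurable borel"
    by (rule borel_measurable_mono)
  have [measurable]: "m \<in> borel_measurable borel"
    using assms by (simp add: rate_fun_def)
  have "serve r W m \<in> borel_measurable borel"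
    unfolding serve_def by measurable
  moreover have "0 \<le> B"
    using assms order_trans[of 0 "m 0" B] by (simp add: rate_fun_def)
  ultimately show ?thesis
    using assms by (auto simp: rate_fun_def serve_def)
qed

text \<open>Service equals the offer up to the first instant at which the offer totals
  \<open>W\<close>, and is zero from then on. That instant exists because the integral is continuous
  in its upper limit.\<close>

lemma integral_serve:
  assumes m: "rate_fun B m" and "r \<le> x" "0 < W"
  shows "integral {r..x} (serve r W m) = min W (integral {r..x} m)"
proof (cases "integral {r..x} m < W")
  case True
  have "serve r W m s = m s" if "s \<in> {r..x}" for s
  proof -
    have "integral {r..s} m \<le> integral {r..x} m"
      using that by (intro rate_fun_integral_mono[OF m]) auto
    then show ?thesis using True that by (simp add: serve_def)
  qed
  then have "integral {r..x} (serve r W m) = integral {r..x} m"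
    by (rule integral_cong)
  then show ?thesis using True by simp
next
  case False
  define Z where "Z = {s \<in> {r..x}. W \<le> integral {r..s} m}"
  have cont: "continuous_on {r..x} (\<lambda>s. integral {r..s} m)"
    by (rule indefinite_integral_continuous_1[OF rate_fun_integrable_on[OF m]])
  have "closed Z"
    unfolding Z_def by (intro continuous_on_closed_Collect_le continuous_on_const cont) simp
  moreover have "bounded Z"
    unfolding Z_def by (rule bounded_subset[of "{r..x}"]) auto
  moreover have "x \<in> Z" using False assms by (simp add: Z_def)
  ultimately obtain y where y: "y \<in> Z" "\<And>s. s \<in> Z \<Longrightarrow> y \<le> s"
    using compact_attains_inf[of Z] by (auto simp: compact_eq_bounded_closed)
  \<comment> \<open>The intermediate value theorem gives a point where exactly \<open>W\<close> has
    been offered; minimality of \<open>y\<close> in \<open>Z\<close> forces that point to be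
    \<open>y\<close>.\<close>
  have "\<exists>z\<ge>r. z \<le> y \<and> integral {r..z} m = W"
    using y(1) assms continuous_on_subset[OF cont, of "{r..y}"]
    by (intro IVT') (auto simp: Z_def)
  then obtain z where z: "r \<le> z" "z \<le> y" "integral {r..z} m = W" by blast
  then have "z \<in> Z" using y(1) by (simp add: Z_def)
  then have hit: "integral {r..y} m = W" using y(2)[of z] z by simp
  have ry: "r \<le> y" "y \<le> x" using y(1) by (auto simp: Z_def)
  have "integral {r..y} (serve r W m) = integral {r..y} m"
  proof (rule integral_spike[of "{y}"])
    fix s assume s: "s \<in> {r..y} - {y}"
    then have "s \<notin> Z" using y(2)[of s] by auto
    then show "m s = serve r W m s" using s ry by (auto simp: Z_def serve_def)
  qed simp
  moreover have "integral {y..x} (serve r W m) = integral {y..x} (\<lambda>_. 0)"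
  proof (rule integral_cong)
    fix s assume s: "s \<in> {y..x}"
    then have "integral {r..y} m \<le> integral {r..s} m"
      by (intro rate_fun_integral_mono[OF m]) auto
    then show "serve r W m s = 0" using hit by (simp add: serve_def)
  qed
  ultimately show ?thesis
    using rate_fun_integral_combine[OF rate_fun_serve[OF m] ry] hit False by simp
qed

text \<open>The window need not contain \<open>r\<close>: widen it until it does, then the part
  before \<open>r\<close> contributes nothing.\<close>

lemma integral_serve_le:
  assumes m: "rate_fun B m" and "0 < W"
  shows "integral {a..b} (serve r W m) \<le> W"
proof -
  define l u where "l = min a r" and "u = max b r"
  have "integral {a..b} (serve r W m) \<le> integral {l..u} (serve r W m)"
    by (intro rate_fun_integral_mono[OF rate_fun_serve[OF m]]) (auto simp: l_def u_def)
  also have "\<dots> = integral {l..r} (serve r W m) + integral {r..u} (serve r W m)"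
    by (intro rate_fun_integral_combine[OF rate_fun_serve[OF m]]) (auto simp: l_def u_def)
  also have "integral {l..r} (serve r W m) = integral {l..r} (\<lambda>_. 0)"
    by (rule integral_spike[of "{r}"]) (auto simp: serve_def)
  also have "integral {r..u} (serve r W m) \<le> W"
    using integral_serve[OF m _ assms(2), of r u] by (simp add: u_def)
  finally show ?thesis by simp
qed

section \<open>Static priorities\<close>

text \<open>A smaller \<open>key\<close> is more urgent, and \<open>cap\<close> limits the rate.
  There are no assumptions, so that causality can compare two arbitrary instances.\<close>

locale priority_queue =
  fixes n :: nat and P :: real and key rel wrk cap :: "nat \<Rightarrow> real"
begin

definition prior :: "nat \<Rightarrow> nat \<Rightarrow> bool" where
  "prior j i \<longleftrightarrow> key j < key i \<or> key j = key i \<and> j < i"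

definition before :: "nat \<Rightarrow> nat set" where
  "before i = {j. j < n \<and> prior j i}"

lemma finite_before [simp]: "finite (before i)"
  by (simp add: before_def)

lemma before_psubset: "j \<in> before i \<Longrightarrow> before j \<subset> before i"
  by (auto simp: before_def prior_def)

lemma before_card_less: "j \<in> before i \<Longrightarrow> card (before j) < card (before i)"
  by (intro psubset_card_mono before_psubset) auto

text \<open>The recursion runs over priorities, not over time: each job is offered, at all instants
  at once, what the more urgent jobs leave over.\<close>

function palloc :: "nat \<Rightarrow> real \<Rightarrow> real" where
  "palloc i s = serve (rel i) (wrk i) (\<lambda>x. min (cap i) (P - (\<Sum>j\<in>before i. palloc j x))) s"
  by auto
termination
  by (relation "Wellfounded.measure (\<lambda>(i, s). card (before i))") (auto intro: before_card_less)

declare palloc.simps [simp del]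

definition offer :: "nat \<Rightarrow> real \<Rightarrow> real" where
  "offer i x = min (cap i) (P - (\<Sum>j\<in>before i. palloc j x))"

lemma palloc_eq: "palloc i = serve (rel i) (wrk i) (offer i)"
  by (rule ext) (simp add: palloc.simps[of i] offer_def[abs_def])

lemma palloc_early: "s < rel i \<Longrightarrow> palloc i s = 0"
  by (simp add: palloc_eq serve_def)

lemma before_induct [case_names less]:
  assumes "\<And>i. (\<And>j. j \<in> before i \<Longrightarrow> Q j) \<Longrightarrow> Q i"
  shows "Q i"
  by (rule measure_induct_rule[of "\<lambda>i. card (before i)"]) (blast intro: assms before_card_less)

text \<open>The witness is the least urgent element. A capacity bound for one job and its
  predecessors thereby becomes a bound for a whole downward closed set.\<close>

lemma down_closed_eq_insert_before:
  assumes "finite A" "A \<noteq> {}" "A \<subseteq> {..<n}" "\<And>i. i \<in> A \<Longrightarrow> before i \<subseteq> A"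
  obtains k where "k \<in> A" "A = insert k (before k)"
proof -
  have "\<exists>k\<in>A. \<forall>j\<in>A. j = k \<or> prior j k"
    using assms(1,2)
  proof (induction A rule: finite_ne_induct)
    case (insert a A)
    then obtain k where k: "k \<in> A" "\<forall>j\<in>A. j = k \<or> prior j k" by blast
    then have "a \<noteq> k" using insert(3) by auto
    then consider "prior a k" | "prior k a"
      unfolding prior_def by (metis linorder_less_linear)
    then show ?case
    proof cases
      case 2
      then have "prior j a" if "prior j k" for j using that by (auto simp: prior_def)
      with k 2 show ?thesis by (intro bexI[of _ a]) auto
    qed (use k in auto)
  qed simp
  then obtain k where "k \<in> A" "\<forall>j\<in>A. j = k \<or> prior j k" by blast
  with assms(3) assms(4)[of k] have "A = insert k (before k)"
    by (auto simp: before_def)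
  with \<open>k \<in> A\<close> show thesis by (rule that)
qed

end

text \<open>Jobs released after \<open>t\<close> get nothing up to \<open>t\<close>, so their keys
  may differ between the instances. The sums over more urgent jobs reduce to released ones, where
  the data agree, and induction on priority applies.\<close>

lemma palloc_causal:
  fixes n n' :: nat and P t s :: real and key rel wrk cap key' rel' wrk' cap' :: "nat \<Rightarrow> real"
  assumes released: "\<And>i. i < n \<and> rel i \<le> t \<longleftrightarrow> i < n' \<and> rel' i \<le> t"
    and same: "\<And>i. i < n \<Longrightarrow> rel i \<le> t \<Longrightarrow>
      rel i = rel' i \<and> key i = key' i \<and> wrk i = wrk' i \<and> cap i = cap' i"
    and "i < n" "i < n'" "s \<le> t"
  shows "priority_queue.palloc n P key rel wrk cap i s = priority_queue.palloc n' P key' rel' wrk' cap' i s"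
proof -
  interpret A: priority_queue n P key rel wrk cap .
  interpret B: priority_queue n' P key' rel' wrk' cap' .
  show ?thesis
    using \<open>i < n\<close> \<open>i < n'\<close> \<open>s \<le> t\<close>
  proof (induction i arbitrary: s rule: A.before_induct)
    case (less i)
    show ?case
    proof (cases "rel i \<le> t")
      case False
      then have "\<not> rel' i \<le> t" using released[of i] less.prems by auto
      then show ?thesis using False less.prems by (simp add: A.palloc_early B.palloc_early)
    next
      case True
      have eq: "rel i = rel' i" "key i = key' i" "wrk i = wrk' i" "cap i = cap' i"
        using same[OF less.prems(1) True] by auto
      have sets: "{j \<in> A.before i. rel j \<le> t} = {j \<in> B.before i. rel' j \<le> t}"
      proof -
        have "j \<in> A.before i \<and> rel j \<le> t \<longleftrightarrow> j \<in> B.before i \<and> rel' j \<le> t" for j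
          using same[of j] released[of j] eq(2)
          by (auto simp: A.before_def B.before_def A.prior_def B.prior_def)
        then show ?thesis by blast
      qed
      have "A.offer i x = B.offer i x" if "x \<le> s" for x
      proof -
        have late: "\<not> rel j \<le> t \<Longrightarrow> A.palloc j x = 0" "\<not> rel' j \<le> t \<Longrightarrow> B.palloc j x = 0" for j
          using that less.prems by (auto intro!: A.palloc_early B.palloc_early)
        have "(\<Sum>j\<in>A.before i. A.palloc j x) = (\<Sum>j\<in>{j \<in> A.before i. rel j \<le> t}. A.palloc j x)"
          by (intro sum.mono_neutral_right) (use late in auto)
        also have "\<dots> = (\<Sum>j\<in>{j \<in> B.before i. rel' j \<le> t}. B.palloc j x)"
        proof (rule sum.cong[OF sets])
          fix j assume j: "j \<in> {j \<in> B.before i. rel' j \<le> t}"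
          then have "j \<in> A.before i" unfolding sets[symmetric] by simp
          then show "A.palloc j x = B.palloc j x"
            using j that less.prems by (intro less.IH) (auto simp: A.before_def B.before_def)
        qed
        also have "\<dots> = (\<Sum>j\<in>B.before i. B.palloc j x)"
          by (intro sum.mono_neutral_left) (use late in auto)
        finally show ?thesis by (simp add: A.offer_def B.offer_def eq)
      qed
      moreover from this have "integral {rel' i..s} (A.offer i) = integral {rel' i..s} (B.offer i)"
        by (intro integral_cong) auto
      ultimately show ?thesis by (simp add: A.palloc_eq B.palloc_eq serve_def eq)
    qed
  qed
qed

text \<open>\<open>volume\<close> is what a machine of speed \<open>P / 4\<close> can finish in a
  window. \<open>span_le_key\<close> says that job \<open>i\<close> running alone at rate
  \<open>cap i\<close> would need at most time \<open>key i\<close>.\<close>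

locale prompt_priority_queue = priority_queue +
  fixes arv :: "nat \<Rightarrow> real"
  assumes P_pos: "0 < P"
    and wrk_pos: "i < n \<Longrightarrow> 0 < wrk i"
    and cap_pos: "i < n \<Longrightarrow> 0 < cap i"
    and cap_le: "i < n \<Longrightarrow> cap i \<le> P"
    and arv_le_rel: "i < n \<Longrightarrow> arv i \<le> rel i"
    and delay_le_key: "i < n \<Longrightarrow> rel i - arv i \<le> key i"
    and span_le_key: "i < n \<Longrightarrow> wrk i \<le> cap i * key i"
    and volume: "a \<le> b \<Longrightarrow> (\<Sum>i\<in>{i. i < n \<and> a \<le> arv i \<and> rel i \<le> b}. wrk i) \<le> P / 4 * (b - a)"
begin

lemma key_pos: "i < n \<Longrightarrow> 0 < key i"
  using wrk_pos[of i] cap_pos[of i] span_le_key[of i] zero_less_mult_pos[of "cap i" "key i"] by linarith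

text \<open>The claims need one another: the offer to \<open>i\<close> is nonnegative because the
  more urgent jobs fit into \<open>P\<close>, which is the third claim for the least urgent of
  them.\<close>

lemma offer_palloc_bounds:
  assumes "i < n"
  shows "rate_fun (cap i) (offer i) \<and> rate_fun (cap i) (palloc i)
    \<and> (\<forall>s. (\<Sum>j\<in>before i. palloc j s) + palloc i s \<le> P)"
  using assms
proof (induction i rule: before_induct)
  case (less i)
  have sub: "before i \<subseteq> {..<n}" by (auto simp: before_def)
  have IH: "rate_fun (cap j) (palloc j)" "(\<Sum>k\<in>before j. palloc k s) + palloc j s \<le> P"
    if "j \<in> before i" for j s
    using less.IH[OF that] sub that by auto
  have le: "(\<Sum>j\<in>before i. palloc j s) \<le> P" for s
  proof (cases "before i = {}")
    case False
    then obtain k where "k \<in> before i" "before i = insert k (before k)"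
      using down_closed_eq_insert_before[of "before i"] sub before_psubset finite_before
      by (metis psubset_imp_subset)
    moreover have "k \<notin> before k" by (simp add: before_def prior_def)
    ultimately show ?thesis using IH(2)[of k s] by (simp add: add.commute)
  qed (use P_pos in simp)
  have [measurable]: "palloc j \<in> borel_measurable borel" if "j \<in> before i" for j
    using IH(1)[OF that] by (simp add: rate_fun_def)
  have "offer i \<in> borel_measurable borel"
    unfolding offer_def[abs_def] by measurable
  then have off: "rate_fun (cap i) (offer i)"
    using le cap_pos[OF less.prems] by (auto simp: rate_fun_def offer_def)
  have "palloc i s \<le> offer i s" for s
    using off by (auto simp: palloc_eq serve_def rate_fun_def)
  then have "palloc i s \<le> P - (\<Sum>j\<in>before i. palloc j s)" for s
    unfolding offer_def by (meson min.boundedE)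
  then have "(\<Sum>j\<in>before i. palloc j s) + palloc i s \<le> P" for s
    by (simp add: le_diff_eq add.commute)
  with off rate_fun_serve[OF off] show ?case by (simp add: palloc_eq)
qed

lemmas rate_fun_offer = offer_palloc_bounds[THEN conjunct1]
  and rate_fun_palloc = offer_palloc_bounds[THEN conjunct2, THEN conjunct1]

lemma palloc_sum_le: "(\<Sum>i<n. palloc i s) \<le> P"
proof (cases "n = 0")
  case False
  then obtain k where k: "k < n" "{..<n} = insert k (before k)"
    using down_closed_eq_insert_before[of "{..<n}"] by (auto simp: before_def)
  moreover have "k \<notin> before k" by (simp add: before_def prior_def)
  ultimately show ?thesis using offer_palloc_bounds[of k] by (simp add: add.commute)
qed (use P_pos in simp)

text \<open>Service since release is capped by the offer since release, so an offer of
  \<open>wrk i\<close> has been reached and \<open>serve\<close> is off, at \<open>s = x\<close> too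
  because its test is strict.\<close>

lemma palloc_done:
  assumes "i < n" "wrk i \<le> integral {a..x} (palloc i)" "x \<le> s"
  shows "palloc i s = 0"
proof (cases "rel i \<le> s")
  case True
  have "integral {a..x} (palloc i) \<le> integral {min a (rel i)..s} (palloc i)"
    using assms by (intro rate_fun_integral_mono[OF rate_fun_palloc]) auto
  also have "\<dots> = integral {min a (rel i)..rel i} (palloc i) + integral {rel i..s} (palloc i)"
    using assms True by (intro rate_fun_integral_combine[OF rate_fun_palloc]) auto
  also have "integral {min a (rel i)..rel i} (palloc i) = integral {min a (rel i)..rel i} (\<lambda>_. 0)"
    by (rule integral_spike[of "{rel i}"]) (auto simp: palloc_early)
  also have "integral {rel i..s} (palloc i) = min (wrk i) (integral {rel i..s} (offer i))"
    unfolding palloc_eq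
    by (rule integral_serve[OF rate_fun_offer[OF assms(1)] True wrk_pos[OF assms(1)]])
  finally have "wrk i \<le> integral {rel i..s} (offer i)" using assms by simp
  then show ?thesis by (simp add: palloc_eq serve_def)
qed (simp add: palloc_early)

text \<open>Suppose job \<open>i\<close> is unfinished at \<open>x\<close>. From its release to
  \<open>x\<close> it either runs at full rate, for less than \<open>key i\<close> in total, or all
  capacity goes to jobs in \<open>H\<close>. By induction the early ones among these are already
  finished, so \<open>volume\<close> bounds the work of the rest.\<close>

lemma prompt_completion:
  assumes "i < n"
  shows "wrk i \<le> integral {arv i..arv i + 4 * key i} (palloc i)"
  using assms
proof (induction i rule: before_induct)
  case (less i)
  define x where "x = arv i + 4 * key i"
  define H where "H = insert i (before i)"
  have H: "finite H" "H \<subseteq> {..<n}" "i \<notin> before i"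
    using less.prems by (auto simp: H_def before_def prior_def)
  have kp: "0 < key i" by (rule key_pos[OF less.prems])
  have rx: "3 * key i \<le> x - rel i" using delay_le_key[OF less.prems] by (simp add: x_def)
  have rx0: "rel i \<le> x" using rx kp by simp
  show ?case
  proof (rule ccontr)
    assume "\<not> ?thesis"
    then have short: "integral {arv i..x} (palloc i) < wrk i" by (simp add: x_def)
    have "integral {rel i..x} (palloc i) \<le> integral {arv i..x} (palloc i)"
      using arv_le_rel[OF less.prems] by (intro rate_fun_integral_mono[OF rate_fun_palloc[OF less.prems]]) auto
    with short have short': "integral {rel i..x} (palloc i) < wrk i" by simp
    have "integral {rel i..x} (offer i) < wrk i"
      using integral_serve[OF rate_fun_offer[OF less.prems] rx0 wrk_pos[OF less.prems]] short'
      by (simp add: palloc_eq[symmetric])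
    \<comment> \<open>An unfinished job accepts everything it is offered.\<close>
    then have act: "palloc i s = offer i s" if "s \<in> {rel i..x}" for s
      using that rate_fun_integral_mono[OF rate_fun_offer[OF less.prems], of "rel i" s "rel i" x]
      by (auto simp: palloc_eq serve_def)
    have int: "palloc j integrable_on {rel i..x}" if "j < n" for j
      by (rule rate_fun_integrable_on[OF rate_fun_palloc[OF that]])
    have nonneg: "0 \<le> palloc j s" if "j < n" for j s
      using rate_fun_palloc[OF that] by (simp add: rate_fun_def)
    have cp: "0 < cap i" by (rule cap_pos[OF less.prems])
    \<comment> \<open>At every instant the unfinished job runs at its full rate or the jobs of at least its
      priority use up the whole capacity.\<close>
    have point: "1 \<le> (\<Sum>j\<in>H. palloc j s) / P + palloc i s / cap i" if "s \<in> {rel i..x}" for s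
    proof (cases "palloc i s = cap i")
      case True
      have "0 \<le> (\<Sum>j\<in>H. palloc j s)" using H nonneg by (intro sum_nonneg) auto
      then show ?thesis using True cp P_pos by simp
    next
      case False
      then have "palloc i s = P - (\<Sum>j\<in>before i. palloc j s)"
        using act[OF that] by (simp add: offer_def split: if_splits)
      then have "(\<Sum>j\<in>H. palloc j s) = P" using H by (simp add: H_def)
      moreover have "0 \<le> palloc i s / cap i" using nonneg[OF less.prems] cp by simp
      ultimately show ?thesis using P_pos by simp
    qed
    have intH: "(\<lambda>s. \<Sum>j\<in>H. palloc j s) integrable_on {rel i..x}"
      using H int by (intro integrable_sum) auto
    have "integral {rel i..x} (\<lambda>_. 1) \<le>
        integral {rel i..x} (\<lambda>s. (\<Sum>j\<in>H. palloc j s) / P + palloc i s / cap i)"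
      using point intH int[OF less.prems]
      by (intro integral_le integrable_add integrable_on_divide) auto
    also have "\<dots> = integral {rel i..x} (\<lambda>s. \<Sum>j\<in>H. palloc j s) / P + integral {rel i..x} (palloc i) / cap i"
      using intH int[OF less.prems]
      by (subst integral_add) (auto intro!: integrable_on_divide)
    also have "integral {rel i..x} (\<lambda>s. \<Sum>j\<in>H. palloc j s) = (\<Sum>j\<in>H. integral {rel i..x} (palloc j))"
      using H int by (intro integral_sum) auto
    finally have main: "x - rel i \<le> (\<Sum>j\<in>H. integral {rel i..x} (palloc j)) / P
        + integral {rel i..x} (palloc i) / cap i"
      using rx0 by simp
    \<comment> \<open>Only these jobs can receive service during \<open>{rel i..x}\<close> among
      those in \<open>H\<close>; the window reaches back by the induction bound
      \<open>4 * key i\<close>.\<close>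
    define V where "V = {j. j < n \<and> rel i - 4 * key i \<le> arv j \<and> rel j \<le> x}"
    have "integral {rel i..x} (palloc j) \<le> (if j \<in> V then wrk j else 0)" if "j \<in> H" for j
    proof (cases "j \<in> V")
      case True
      then have "j < n" by (simp add: V_def)
      then show ?thesis
        using True integral_serve_le[OF rate_fun_offer wrk_pos] by (simp add: palloc_eq)
    next
      case False
      have jn: "j < n" using that H by auto
      have "palloc j s = 0" if "s \<in> {rel i..x}" for s
      proof (cases "rel j \<le> x")
        case True
        \<comment> \<open>Since \<open>key j \<le> key i\<close>, the induction hypothesis finishes
          such a \<open>j\<close> by \<open>arv j + 4 * key j < rel i\<close>.\<close>
        with False jn have far: "arv j < rel i - 4 * key i" by (auto simp: V_def)
        then have "j \<noteq> i" using delay_le_key[OF less.prems] kp by auto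
        then have jb: "j \<in> before i" using \<open>j \<in> H\<close> by (simp add: H_def)
        then have "key j \<le> key i" by (auto simp: before_def prior_def)
        then show ?thesis
          using palloc_done[OF jn less.IH[OF jb jn], of s] far that by auto
      qed (use that in \<open>auto intro: palloc_early\<close>)
      then have "integral {rel i..x} (palloc j) = integral {rel i..x} (\<lambda>_. 0)"
        by (rule integral_cong)
      then show ?thesis using False by simp
    qed
    then have "(\<Sum>j\<in>H. integral {rel i..x} (palloc j)) \<le> (\<Sum>j\<in>H. if j \<in> V then wrk j else 0)"
      by (rule sum_mono)
    also have "\<dots> = (\<Sum>j\<in>H \<inter> V. wrk j)" using H by (simp add: sum.inter_restrict)
    also have "\<dots> \<le> (\<Sum>j\<in>V. wrk j)"
      using wrk_pos by (intro sum_mono2) (auto simp: V_def less_imp_le)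
    also have "\<dots> \<le> P / 4 * (x - (rel i - 4 * key i))"
      unfolding V_def using rx0 kp by (intro volume) simp
    finally have "(\<Sum>j\<in>H. integral {rel i..x} (palloc j)) / P \<le> (x - rel i) / 4 + key i"
      using P_pos by (simp add: field_simps)
    moreover have "integral {rel i..x} (palloc i) / cap i < key i"
      using short' span_le_key[OF less.prems] cp by (simp add: field_simps)
    \<comment> \<open>With \<open>L = x - rel i\<close> the bounds give
      \<open>L < L / 4 + 2 * key i\<close>, so \<open>L < 8 / 3 * key i\<close>, against
      \<open>L \<ge> 3 * key i\<close>.\<close>
    ultimately show False using main rx kp by argo
  qed
qed

end

section \<open>The virtual machine\<close>

definition impl_work :: "bool \<Rightarrow> task \<Rightarrow> real" where
  "impl_work b x = (if b then par x else sig x)"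

definition vlen :: "nat \<Rightarrow> bool \<Rightarrow> task \<Rightarrow> real" where
  "vlen p b x = 4 * impl_work b x / real p"

definition pen :: "bool \<Rightarrow> task \<Rightarrow> real" where
  "pen b x = (if b then 0 else sig x)"

text \<open>This is the marginal cost of an insertion: the new task's own virtual response time, one
  shift by its length for each task delayed, and the penalty.\<close>

definition icost :: "nat \<Rightarrow> task \<Rightarrow> nat \<Rightarrow> (nat \<Rightarrow> real) \<Rightarrow> real \<Rightarrow> bool \<Rightarrow> real" where
  "icost p x k C \<theta> b =
     (\<theta> - arr x) + vlen p b x * (1 + real (card {i. i < k \<and> \<theta> < C i})) + pen b x"

text \<open>Besides minimality, it matters that the choice is a function of the arriving task and
  the current predictions; the online property rests on this.\<close>

definition best :: "nat \<Rightarrow> task \<Rightarrow> nat \<Rightarrow> (nat \<Rightarrow> real) \<Rightarrow> real \<times> bool" where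
  "best p x k C = (SOME z. arr x \<le> fst z \<and>
     (\<forall>\<theta> b. arr x \<le> \<theta> \<longrightarrow> icost p x k C (fst z) (snd z) \<le> icost p x k C \<theta> b))"

text \<open>The infinitely many instants reduce to the finite set \<open>K\<close>: between
  consecutive predicted completions the count is constant and the cost grows with
  \<open>\<theta>\<close>, so rounding \<open>\<theta>\<close> down to \<open>K\<close> never
  hurts.\<close>

lemma best_minimal:
  shows "arr x \<le> fst (best p x k C)"
    and "arr x \<le> \<theta> \<Longrightarrow> icost p x k C (fst (best p x k C)) (snd (best p x k C)) \<le> icost p x k C \<theta> b"
proof -
  define K where "K = insert (arr x) {y \<in> C ` {..<k}. arr x \<le> y}"
  have finK: "finite K" by (simp add: K_def)
  have "finite (K \<times> (UNIV :: bool set))" "K \<times> (UNIV :: bool set) \<noteq> {}"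
    using finK by (auto simp: K_def)
  then obtain z where z: "z \<in> K \<times> UNIV"
      "\<And>y. y \<in> K \<times> UNIV \<Longrightarrow> icost p x k C (fst z) (snd z) \<le> icost p x k C (fst y) (snd y)"
    using ex_min_if_finite[of "(\<lambda>y. icost p x k C (fst y) (snd y)) ` (K \<times> UNIV)"]
    by (fastforce simp: not_less)
  have "icost p x k C (fst z) (snd z) \<le> icost p x k C \<theta> b" if "arr x \<le> \<theta>" for \<theta> b
  proof -
    define \<theta>' where "\<theta>' = Max {y \<in> K. y \<le> \<theta>}"
    have fin: "finite {y \<in> K. y \<le> \<theta>}" "{y \<in> K. y \<le> \<theta>} \<noteq> {}"
      using finK that by (auto simp: K_def)
    have \<theta>': "\<theta>' \<in> K" "\<theta>' \<le> \<theta>" using Max_in[OF fin] by (auto simp: \<theta>'_def)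
    have up: "y \<le> \<theta>'" if "y \<in> K" "y \<le> \<theta>" for y
      unfolding \<theta>'_def using fin(1) that by (intro Max_ge) auto
    have ax: "arr x \<le> \<theta>'" using \<theta>'(1) by (auto simp: K_def)
    have "\<theta> < C i" if "i < k" "\<theta>' < C i" for i
      using up[of "C i"] that ax by (force simp: K_def not_le[symmetric])
    then have "{i. i < k \<and> \<theta>' < C i} = {i. i < k \<and> \<theta> < C i}"
      using \<theta>'(2) by force
    then have "icost p x k C \<theta>' b \<le> icost p x k C \<theta> b"
      using \<theta>'(2) by (simp add: icost_def)
    moreover have "icost p x k C (fst z) (snd z) \<le> icost p x k C \<theta>' b"
      using z(2)[of "(\<theta>', b)"] \<theta>'(1) by simp
    ultimately show ?thesis by simp
  qed
  moreover have "arr x \<le> fst z" using z(1) by (auto simp: K_def)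
  ultimately have "\<exists>z. arr x \<le> fst z \<and>
     (\<forall>\<theta> b. arr x \<le> \<theta> \<longrightarrow> icost p x k C (fst z) (snd z) \<le> icost p x k C \<theta> b)"
    by blast
  from someI_ex[OF this] show "arr x \<le> fst (best p x k C)"
    and "arr x \<le> \<theta> \<Longrightarrow> icost p x k C (fst (best p x k C)) (snd (best p x k C)) \<le> icost p x k C \<theta> b"
    by (auto simp: best_def)
qed

text \<open>\<open>vcomp p T k i\<close> is the virtual completion time of task \<open>i\<close> as predicted after the first
  \<open>k\<close> arrivals; it is meaningful only for \<open>i < k\<close>.\<close>

primrec vcomp :: "nat \<Rightarrow> task list \<Rightarrow> nat \<Rightarrow> nat \<Rightarrow> real" where
  "vcomp p T 0 = (\<lambda>_. 0)"
| "vcomp p T (Suc k) = (\<lambda>i.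
     let \<theta> = fst (best p (T ! k) k (vcomp p T k)); b = snd (best p (T ! k) k (vcomp p T k)) in
     if i = k then \<theta> + vlen p b (T ! k)
     else if \<theta> < vcomp p T k i then vcomp p T k i + vlen p b (T ! k)
     else vcomp p T k i)"

definition vslot :: "nat \<Rightarrow> task list \<Rightarrow> nat \<Rightarrow> real" where
  "vslot p T k = fst (best p (T ! k) k (vcomp p T k))"

definition vimpl :: "nat \<Rightarrow> task list \<Rightarrow> nat \<Rightarrow> bool" where
  "vimpl p T k = snd (best p (T ! k) k (vcomp p T k))"

definition dual :: "nat \<Rightarrow> task list \<Rightarrow> nat \<Rightarrow> real" where
  "dual p T k = icost p (T ! k) k (vcomp p T k) (vslot p T k) (vimpl p T k)"

lemma vcomp_Suc:
  "vcomp p T (Suc k) i =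
    (if i = k then vslot p T k + vlen p (vimpl p T k) (T ! k)
     else if vslot p T k < vcomp p T k i then vcomp p T k i + vlen p (vimpl p T k) (T ! k)
     else vcomp p T k i)"
  by (simp add: vslot_def vimpl_def Let_def)

lemma arr_le_vslot: "arr (T ! k) \<le> vslot p T k"
  unfolding vslot_def by (rule best_minimal(1))

lemma dual_le: "arr (T ! k) \<le> \<theta> \<Longrightarrow> dual p T k \<le> icost p (T ! k) k (vcomp p T k) \<theta> b"
  unfolding dual_def vslot_def vimpl_def by (rule best_minimal(2))

text \<open>The equality is between functions, indices beyond \<open>k\<close> included, because
  \<open>best\<close> receives the whole function.\<close>

lemma vcomp_take_cong:
  assumes "take k T = take k T'" "k \<le> length T" "k \<le> length T'"
  shows "vcomp p T k = vcomp p T' k"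
  using assms
proof (induction k)
  case (Suc k)
  then have nth: "T ! k = T' ! k" by (metis lessI nth_take)
  have "take k T = take k T'" using Suc.prems by (metis min.absorb1 le_add2 plus_1_eq_Suc take_take)
  then have "vcomp p T k = vcomp p T' k" using Suc by simp
  then show ?case by (simp only: vcomp.simps nth)
qed simp

lemma vimpl_take_cong:
  assumes "take k T = take k T'" "k \<le> length T" "k \<le> length T'" "i < k"
  shows "vimpl p T i = vimpl p T' i"
proof -
  have "take i T = take i T'" using assms by (metis min.absorb1 less_imp_le take_take)
  moreover have "T ! i = T' ! i" using assms by (metis nth_take)
  ultimately show ?thesis using vcomp_take_cong[of i T T' p] assms by (simp add: vimpl_def)
qed

declare vcomp.simps(2) [simp del]

section \<open>Invariants of the virtual schedule\<close>

locale tap =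
  fixes p :: nat and T :: "task list"
  assumes p_pos: "1 \<le> p" and valid: "valid_tap p T"
begin

lemma task_bounds:
  assumes "i < length T"
  shows "0 < sig (T ! i)" "sig (T ! i) \<le> par (T ! i)"
    "par (T ! i) \<le> real p * sig (T ! i)" "0 \<le> arr (T ! i)"
  using valid assms by (auto simp: valid_tap_def)

lemma arr_mono: "i \<le> j \<Longrightarrow> j < length T \<Longrightarrow> arr (T ! i) \<le> arr (T ! j)"
  using valid sorted_nth_mono[of "map arr T" i j] by (auto simp: valid_tap_def)

lemma impl_work_pos: "i < length T \<Longrightarrow> 0 < impl_work b (T ! i)"
  using task_bounds[of i] by (auto simp: impl_work_def)

lemma vlen_pos: "i < length T \<Longrightarrow> 0 < vlen p b (T ! i)"
  using impl_work_pos p_pos by (simp add: vlen_def)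

lemma pen_nonneg: "i < length T \<Longrightarrow> 0 \<le> pen b (T ! i)"
  using task_bounds[of i] by (simp add: pen_def)

lemma vcomp_mono_Suc: "k < length T \<Longrightarrow> i < k \<Longrightarrow> vcomp p T k i \<le> vcomp p T (Suc k) i"
  using vlen_pos[of k "vimpl p T k"] by (simp add: vcomp_Suc)

lemma vcomp_mono:
  assumes "k \<le> l" "l \<le> length T" "i < k"
  shows "vcomp p T k i \<le> vcomp p T l i"
  using assms
proof (induction l rule: dec_induct)
  case (step l)
  then show ?case using vcomp_mono_Suc[of l i] by linarith
qed simp

text \<open>A later task is inserted no earlier than its arrival, hence after \<open>t\<close>, and
  so never shifts a prediction that is at most \<open>t\<close>.\<close>

lemma vcomp_stable:
  assumes "k \<le> l" "l \<le> length T" "i < k" "\<And>j. k \<le> j \<Longrightarrow> j < l \<Longrightarrow> t < arr (T ! j)"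
    and "vcomp p T k i \<le> t"
  shows "vcomp p T l i = vcomp p T k i"
  using assms
proof (induction l rule: dec_induct)
  case (step l)
  then have "vcomp p T l i = vcomp p T k i" by auto
  moreover have "t < vslot p T l" using step arr_le_vslot[of T l p] by fastforce
  ultimately show ?case using step by (simp add: vcomp_Suc)
qed simp

lemma arr_vlen_le_vcomp:
  assumes "i < k" "k \<le> length T"
  shows "arr (T ! i) + vlen p (vimpl p T i) (T ! i) \<le> vcomp p T k i"
  using vcomp_mono[of "Suc i" k i] assms arr_le_vslot[of T i p] by (simp add: vcomp_Suc)

text \<open>Telescoping: each \<open>dual\<close> value is exactly the increase of the total virtual
  cost caused by that arrival.\<close>

lemma dual_sum:
  assumes "k \<le> length T"
  shows "(\<Sum>i<k. vcomp p T k i - arr (T ! i) + pen (vimpl p T i) (T ! i)) = (\<Sum>i<k. dual p T i)"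
  using assms
proof (induction k)
  case (Suc k)
  let ?v = "vlen p (vimpl p T k) (T ! k)"
  have "(\<Sum>i<k. vcomp p T (Suc k) i - arr (T ! i) + pen (vimpl p T i) (T ! i)) =
      (\<Sum>i<k. (vcomp p T k i - arr (T ! i) + pen (vimpl p T i) (T ! i))
        + (if vslot p T k < vcomp p T k i then ?v else 0))"
    by (intro sum.cong) (auto simp: vcomp_Suc)
  also have "\<dots> = (\<Sum>i<k. dual p T i) + (\<Sum>i<k. if vslot p T k < vcomp p T k i then ?v else 0)"
    using Suc by (simp add: sum.distrib)
  also have "(\<Sum>i<k. if vslot p T k < vcomp p T k i then ?v else 0) =
      ?v * card {i. i < k \<and> vslot p T k < vcomp p T k i}"
    by (simp add: sum.If_cases Collect_conj_eq lessThan_def)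
  finally show ?case
    by (simp add: vcomp_Suc dual_def icost_def algebra_simps)
qed simp

text \<open>Induction over arrivals with \<open>b\<close> varying. If the new task ends after
  \<open>b\<close>, the window gains nothing. Otherwise removing it moves the right end back by its
  length; if that end falls before \<open>a\<close>, the new task, and with it every earlier one,
  arrived before \<open>a\<close>.\<close>

lemma vcomp_volume:
  assumes "k \<le> length T" "a \<le> b"
  shows "(\<Sum>i\<in>{i. i < k \<and> a \<le> arr (T ! i) \<and> vcomp p T k i \<le> b}. vlen p (vimpl p T i) (T ! i)) \<le> b - a"
  using assms
proof (induction k arbitrary: b)
  case (Suc k)
  let ?v = "\<lambda>i. vlen p (vimpl p T i) (T ! i)"
  define S where "S k b = {i. i < k \<and> a \<le> arr (T ! i) \<and> vcomp p T k i \<le> b}" for k b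
  have k: "k < length T" using Suc by simp
  have vp: "0 < ?v i" if "i \<le> k" for i using vlen_pos that k by simp
  consider "b < vslot p T k + ?v k" | "vslot p T k + ?v k \<le> b" "a \<le> b - ?v k"
    | "vslot p T k + ?v k \<le> b" "b - ?v k < a" by linarith
  then have "sum ?v (S (Suc k) b) \<le> b - a"
  proof cases
    case 1
    then have "S (Suc k) b \<subseteq> S k b"
      using vp[of k] by (auto simp: S_def vcomp_Suc less_Suc_eq split: if_splits)
    then have "sum ?v (S (Suc k) b) \<le> sum ?v (S k b)"
      using vp by (intro sum_mono2) (auto simp: S_def less_imp_le)
    also have "\<dots> \<le> b - a" using Suc by (simp add: S_def)
    finally show ?thesis .
  next
    case 2
    then have "S (Suc k) b \<subseteq> insert k (S k (b - ?v k))"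
      by (auto simp: S_def vcomp_Suc less_Suc_eq split: if_splits)
    then have "sum ?v (S (Suc k) b) \<le> sum ?v (insert k (S k (b - ?v k)))"
      using vp by (intro sum_mono2) (auto simp: S_def less_imp_le)
    also have "\<dots> = ?v k + sum ?v (S k (b - ?v k))"
      by (subst sum.insert) (auto simp: S_def)
    also have "sum ?v (S k (b - ?v k)) \<le> b - ?v k - a"
      using Suc.IH[of "b - ?v k"] Suc.prems 2 by (simp add: S_def)
    finally show ?thesis by simp
  next
    case 3
    then have "arr (T ! i) < a" if "i < Suc k" for i
      using arr_mono[of i k] arr_le_vslot[of T k p] k that by linarith
    then have "S (Suc k) b = {}" by (force simp: S_def not_le[symmetric])
    then show ?thesis using Suc.prems by simp
  qed
  then show ?case by (simp add: S_def)
qed simp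

section \<open>Weak duality against an arbitrary feasible schedule\<close>

definition vfin :: "nat \<Rightarrow> real" where "vfin = vcomp p T (length T)"

text \<open>Weak duality: the slot cost at \<open>t\<close> is averaged over the instants \<open>t\<close> at which the
  competing schedule serves the task.\<close>

lemma dual_le_schedule:
  assumes S: "feasible p (scale_tap 8 T) S" and j: "j < length T"
  defines "f \<equiv> completion (scale_tap 8 T) S j - arr (T ! j)"
  shows "dual p T j \<le> 13 / 8 * f + (\<Sum>i<length T. integral {arr (T ! i)..vfin i} (alloc S j)) / (2 * p)"
proof -
  define a where "a = alloc S j"
  define b where "b = choice S j"
  define \<tau> where "\<tau> = arr (T ! j)"
  define w where "w = impl_work b (T ! j)"
  define v where "v = vlen p b (T ! j)"
  define Cj where "Cj = completion (scale_tap 8 T) S j"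
  have len: "length (scale_tap 8 T) = length T" by (simp add: scale_tap_def)
  have arr_s: "arr (scale_tap 8 T ! j) = \<tau>"
    using j by (simp add: scale_tap_def arr_def \<tau>_def)
  have work_s: "work (scale_tap 8 T) S j = 8 * w"
    using j by (simp add: work_def scale_tap_def w_def impl_work_def b_def par_def sig_def)
  have w0: "0 < w" unfolding w_def by (rule impl_work_pos[OF j])
  have feas: "a \<in> borel_measurable borel" "\<And>s. 0 \<le> a s" "\<not> b \<Longrightarrow> a s \<le> 1"
      "\<exists>x. \<tau> \<le> x \<and> 8 * w \<le> cum S j \<tau> x" "\<And>s. Cj < s \<Longrightarrow> a s = 0" for s
    using S j
    unfolding feasible_def len a_def b_def Cj_def arr_s[symmetric] work_s[symmetric] by auto
  have ra: "rate_fun p a" unfolding a_def using feasible_rate_fun[OF S] j len by simp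
  have cum_eq: "cum S j \<tau> x = integral {\<tau>..x} a" for x
    unfolding cum_def a_def[symmetric] by (rule rate_fun_LINT[OF ra])
  \<comment> \<open>The largest rate at which \<open>S\<close> can serve the task under its own
    choice of implementation.\<close>
  define cp :: real where "cp = (if b then p else 1)"
  have cp0: "0 < cp" using p_pos by (simp add: cp_def)
  have rc: "rate_fun cp a" using ra feas by (simp add: rate_fun_def cp_def)
  have fast: "8 * w \<le> cp * (Cj - \<tau>)"
  proof -
    have "\<tau> + 8 * w / cp \<le> Cj"
      unfolding Cj_def completion_def arr_s work_s
    proof (rule cInf_greatest)
      show "{x. \<tau> \<le> x \<and> 8 * w \<le> cum S j \<tau> x} \<noteq> {}" using feas(4) by auto
      fix x assume "x \<in> {x. \<tau> \<le> x \<and> 8 * w \<le> cum S j \<tau> x}"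
      then have "8 * w \<le> cp * (x - \<tau>)"
        using rate_fun_integral_le[OF rc, of \<tau> x] by (simp add: cum_eq)
      then show "\<tau> + 8 * w / cp \<le> x" using cp0 by (simp add: field_simps)
    qed
    then show ?thesis using cp0 by (simp add: field_simps)
  qed
  have f0: "f = Cj - \<tau>" by (simp add: f_def Cj_def \<tau>_def)
  have "0 \<le> f" using fast w0 cp0 f0 by (smt (verit) mult_nonneg_nonpos)
  moreover have "cp \<le> p" using p_pos by (simp add: cp_def)
  ultimately have "8 * w \<le> p * f"
    using fast f0 by (smt (verit) mult_right_mono)
  then have v_le: "v \<le> f / 2" using p_pos by (simp add: v_def vlen_def w_def[symmetric] field_simps)
  have pen_le: "pen b (T ! j) \<le> f / 8"
    using fast f0 \<open>0 \<le> f\<close> by (auto simp: pen_def w_def impl_work_def cp_def)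
  \<comment> \<open>By \<open>v \<le> f / 2\<close> and the penalty bound \<open>f / 8\<close>, this
    is at most \<open>13 / 8 * f\<close>.\<close>
  define B where "B = f + v + pen b (T ! j)"
  obtain x where x: "\<tau> \<le> x" "8 * w \<le> integral {\<tau>..x} a" using feas(4) cum_eq by auto
  \<comment> \<open>The service that \<open>S\<close> gives to \<open>j\<close> while task
    \<open>i\<close> is virtually alive.\<close>
  define g where "g i t = (if t \<in> {arr (T ! i)..vfin i} then a t else 0)" for i t
  have v0: "0 < v" unfolding v_def by (rule vlen_pos[OF j])
  \<comment> \<open>Compare \<open>dual\<close> with insertion at \<open>\<theta> = t\<close> under
    the implementation used by \<open>S\<close>, weighted by the rate \<open>a t\<close>. Past
    \<open>Cj\<close> both sides vanish.\<close>
  have point: "dual p T j * a t \<le> B * a t + v * (\<Sum>i<length T. g i t)" if t: "t \<in> {\<tau>..x}" for t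
  proof (cases "t \<le> Cj")
    case True
    have "real (card {i. i < j \<and> t < vcomp p T j i}) * a t = (\<Sum>i\<in>{i. i < j \<and> t < vcomp p T j i}. a t)"
      by simp
    also have "\<dots> = (\<Sum>i\<in>{i. i < j \<and> t < vcomp p T j i}. g i t)"
    proof (rule sum.cong)
      fix i assume i: "i \<in> {i. i < j \<and> t < vcomp p T j i}"
      then have "arr (T ! i) \<le> \<tau>" unfolding \<tau>_def using arr_mono[of i j] j by simp
      moreover have "vcomp p T j i \<le> vfin i" unfolding vfin_def using vcomp_mono i j by simp
      ultimately show "a t = g i t" using i t by (auto simp: g_def)
    qed simp
    also have "\<dots> \<le> (\<Sum>i<length T. g i t)"
      using j feas(2) by (intro sum_mono2) (auto simp: g_def)
    finally have cnt: "v * (real (card {i. i < j \<and> t < vcomp p T j i}) * a t) \<le> v * (\<Sum>i<length T. g i t)"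
      using v0 by simp
    have "dual p T j \<le> (t - \<tau>) + v * (1 + real (card {i. i < j \<and> t < vcomp p T j i})) + pen b (T ! j)"
      using dual_le[of T j t p b] t by (simp add: icost_def \<tau>_def v_def)
    also have "\<dots> \<le> B + v * real (card {i. i < j \<and> t < vcomp p T j i})"
      using True by (simp add: B_def f0 algebra_simps)
    finally have "dual p T j * a t \<le> (B + v * real (card {i. i < j \<and> t < vcomp p T j i})) * a t"
      using feas(2) by (intro mult_right_mono)
    then show ?thesis using cnt by (simp add: algebra_simps)
  next
    case False
    then have "a t = 0" by (intro feas(5)) simp
    moreover from this have "g i t = 0" for i by (simp add: g_def)
    ultimately show ?thesis by simp
  qed
  have rg: "rate_fun p (g i)" for i
    using ra unfolding rate_fun_def g_def by auto
  note int = rate_fun_integrable_on[OF ra] rate_fun_integrable_on[OF rg]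
  have intC: "(\<lambda>t. c * a t) integrable_on {\<tau>..x}"
      "(\<lambda>t. c * (\<Sum>i<length T. g i t)) integrable_on {\<tau>..x}" for c
    using integrable_on_cmult_left[OF int(1), of c]
      integrable_on_cmult_left[OF integrable_sum[of "{..<length T}" g, OF _ int(2)], of c]
    by simp_all
  define I where "I = integral {\<tau>..x} a"
  define X where "X = (\<Sum>i<length T. integral {arr (T ! i)..vfin i} a)"
  have I0: "0 < I" "8 * w \<le> I" using x w0 by (auto simp: I_def)
  have X0: "0 \<le> X" unfolding X_def by (intro sum_nonneg rate_fun_integral_nonneg[OF ra])
  have "dual p T j * I = integral {\<tau>..x} (\<lambda>t. dual p T j * a t)"
    by (simp add: I_def)
  also have "\<dots> \<le> integral {\<tau>..x} (\<lambda>t. B * a t + v * (\<Sum>i<length T. g i t))"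
    using point by (intro integral_le intC integrable_add) auto
  also have "\<dots> = B * I + v * (\<Sum>i<length T. integral {\<tau>..x} (g i))"
    using intC int by (simp add: integral_add I_def integral_sum)
  also have "(\<Sum>i<length T. integral {\<tau>..x} (g i)) \<le> X"
    unfolding X_def
  proof (rule sum_mono)
    fix i
    have "integral {\<tau>..x} (g i) = integral ({arr (T ! i)..vfin i} \<inter> {\<tau>..x}) a"
      unfolding g_def by (rule integral_restrict_Int)
    also have "\<dots> \<le> integral {arr (T ! i)..vfin i} a"
      unfolding Int_atLeastAtMost by (rule rate_fun_integral_mono[OF ra]) auto
    finally show "integral {\<tau>..x} (g i) \<le> integral {arr (T ! i)..vfin i} a" .
  qed
  finally have "dual p T j * I \<le> B * I + v * X" using v0 by simp
  then have "dual p T j \<le> B + v * X / I" using I0 by (simp add: field_simps)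
  \<comment> \<open>The schedule serves at least \<open>8 * w\<close>, while
    \<open>v = 4 * w / p\<close>; hence the factor \<open>1 / (2 * p)\<close>.\<close>
  also have "v * X / I \<le> v * X / (8 * w)"
    using I0 w0 X0 v0 by (intro divide_left_mono) auto
  also have "\<dots> = X / (2 * p)"
    using w0 p_pos by (simp add: v_def vlen_def w_def[symmetric])
  finally show ?thesis
    using v_le pen_le by (simp add: B_def X_def a_def)
qed

text \<open>Summed over \<open>j\<close>, the overlap terms for a fixed \<open>i\<close> total at
  most \<open>p\<close> times the virtual response time of \<open>i\<close>, since \<open>S\<close>
  uses at most \<open>p\<close> processors. After division by \<open>2 * p\<close> they amount to at
  most half of the left side and are absorbed, doubling \<open>13 / 8\<close>.\<close>

lemma dual_sum_le_TRT:
  assumes S: "feasible p (scale_tap 8 T) S"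
  shows "(\<Sum>i<length T. dual p T i) \<le> 13 / 4 * TRT (scale_tap 8 T) S"
proof -
  let ?n = "length T"
  have len: "length (scale_tap 8 T) = ?n" by (simp add: scale_tap_def)
  have ra: "rate_fun p (alloc S j)" if "j < ?n" for j
    using feasible_rate_fun[OF S] that len by simp
  have TRT_eq: "TRT (scale_tap 8 T) S = (\<Sum>j<?n. completion (scale_tap 8 T) S j - arr (T ! j))"
    unfolding TRT_def len by (intro sum.cong) (auto simp: scale_tap_def arr_def)
  have busy: "(\<Sum>j<?n. integral {arr (T ! i)..vfin i} (alloc S j)) \<le> p * (vfin i - arr (T ! i))"
    if i: "i < ?n" for i
  proof -
    have le: "arr (T ! i) \<le> vfin i"
      using arr_vlen_le_vcomp[of i ?n] vlen_pos[of i "vimpl p T i"] i by (simp add: vfin_def)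
    have "(\<Sum>j<?n. integral {arr (T ! i)..vfin i} (alloc S j)) =
        integral {arr (T ! i)..vfin i} (\<lambda>s. \<Sum>j<?n. alloc S j s)"
      using ra by (intro integral_sum[symmetric] rate_fun_integrable_on) auto
    also have "\<dots> \<le> integral {arr (T ! i)..vfin i} (\<lambda>_. real p)"
      using ra S by (intro integral_le integrable_sum integrable_const_ivl)
        (auto simp: feasible_def len intro: rate_fun_integrable_on)
    finally show ?thesis using le by (simp add: mult.commute)
  qed
  define X where "X = (\<Sum>j<?n. \<Sum>i<?n. integral {arr (T ! i)..vfin i} (alloc S j))"
  have "X = (\<Sum>i<?n. \<Sum>j<?n. integral {arr (T ! i)..vfin i} (alloc S j))"
    unfolding X_def by (rule sum.swap)
  also have "\<dots> \<le> (\<Sum>i<?n. p * (vfin i - arr (T ! i)))"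
    using busy by (intro sum_mono) auto
  also have "\<dots> = p * (\<Sum>i<?n. vfin i - arr (T ! i))"
    by (simp add: sum_distrib_left)
  also have "\<dots> \<le> p * (\<Sum>i<?n. dual p T i)"
    unfolding dual_sum[OF order_refl, symmetric] vfin_def
    using pen_nonneg by (intro mult_left_mono sum_mono) auto
  finally have X: "X / (2 * p) \<le> (\<Sum>i<?n. dual p T i) / 2"
    using p_pos by (simp add: field_simps)
  have "(\<Sum>j<?n. dual p T j) \<le> (\<Sum>j<?n. 13 / 8 * (completion (scale_tap 8 T) S j - arr (T ! j))
      + (\<Sum>i<?n. integral {arr (T ! i)..vfin i} (alloc S j)) / (2 * p))"
    using dual_le_schedule[OF S] by (intro sum_mono) auto
  also have "\<dots> = 13 / 8 * TRT (scale_tap 8 T) S + X / (2 * p)"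
    by (simp add: X_def sum.distrib TRT_eq sum_distrib_left sum_divide_distrib)
  finally show ?thesis using X by linarith
qed

end

section \<open>The scheduler\<close>

definition vkey :: "nat \<Rightarrow> task list \<Rightarrow> nat \<Rightarrow> real" where
  "vkey p T i = vcomp p T (length T) i - arr (T ! i) + pen (vimpl p T i) (T ! i)"

definition vwork :: "nat \<Rightarrow> task list \<Rightarrow> nat \<Rightarrow> real" where
  "vwork p T i = impl_work (vimpl p T i) (T ! i)"

definition vcap :: "nat \<Rightarrow> task list \<Rightarrow> nat \<Rightarrow> real" where
  "vcap p T i = (if vimpl p T i then real p else 1)"

text \<open>Releases and keys are read off the final predictions for the whole list. This is still
  online, since a prediction is settled by the time it is reached.\<close>

definition greedy_alg :: "nat \<Rightarrow> task list \<Rightarrow> sched" where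
  "greedy_alg p T = (vimpl p T, priority_queue.palloc (length T) (real p) (vkey p T)
     (vcomp p T (length T)) (vwork p T) (vcap p T))"

context tap
begin

lemma prompt: "prompt_priority_queue (length T) (real p) (vkey p T)
  (vcomp p T (length T)) (vwork p T) (vcap p T) (\<lambda>i. arr (T ! i))"
proof
  show "0 < real p" using p_pos by simp
next
  fix i assume i: "i < length T"
  have late: "arr (T ! i) + vlen p (vimpl p T i) (T ! i) \<le> vcomp p T (length T) i"
    by (rule arr_vlen_le_vcomp[OF i order_refl])
  have v0: "0 < vlen p (vimpl p T i) (T ! i)" by (rule vlen_pos[OF i])
  have pen0: "0 \<le> pen (vimpl p T i) (T ! i)" by (rule pen_nonneg[OF i])
  show "0 < vwork p T i" unfolding vwork_def by (rule impl_work_pos[OF i])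
  show "0 < vcap p T i" "vcap p T i \<le> real p" using p_pos by (auto simp: vcap_def)
  show "arr (T ! i) \<le> vcomp p T (length T) i" using late v0 by simp
  show "vcomp p T (length T) i - arr (T ! i) \<le> vkey p T i" using pen0 by (simp add: vkey_def)
  show "vwork p T i \<le> vcap p T i * vkey p T i"
  \<comment> \<open>A parallel job is covered by its virtual length
    \<open>4 * par (T ! i) / p\<close>, a serial one by its penalty.\<close>
  proof (cases "vimpl p T i")
    case True
    have "4 * par (T ! i) / p \<le> vkey p T i"
      using late pen0 True by (simp add: vkey_def vlen_def impl_work_def)
    then have "4 * par (T ! i) \<le> p * vkey p T i" using p_pos by (simp add: field_simps)
    then show ?thesis using True task_bounds(1,2)[OF i] by (simp add: vwork_def vcap_def impl_work_def)
  next
    case False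
    then show ?thesis using late v0 by (simp add: vwork_def vcap_def impl_work_def vkey_def pen_def)
  qed
next
  fix a b :: real assume "a \<le> b"
  let ?V = "{i. i < length T \<and> a \<le> arr (T ! i) \<and> vcomp p T (length T) i \<le> b}"
  have "(\<Sum>i\<in>?V. vwork p T i) = real p / 4 * (\<Sum>i\<in>?V. vlen p (vimpl p T i) (T ! i))"
    using p_pos by (simp add: sum_distrib_left vlen_def vwork_def)
  also have "\<dots> \<le> real p / 4 * (b - a)"
    using vcomp_volume[OF order_refl \<open>a \<le> b\<close>] by (intro mult_left_mono) auto
  finally show "(\<Sum>i\<in>?V. vwork p T i) \<le> real p / 4 * (b - a)" .
qed

sublocale Q: prompt_priority_queue "length T" "real p" "vkey p T"
  "vcomp p T (length T)" "vwork p T" "vcap p T" "\<lambda>i. arr (T ! i)"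
  by (rule prompt)

section \<open>Feasibility and cost of the scheduler\<close>

lemma alloc_greedy: "alloc (greedy_alg p T) = Q.palloc"
  by (simp add: alloc_def greedy_alg_def)

lemma work_greedy: "work T (greedy_alg p T) i = vwork p T i"
  by (simp add: work_def choice_def greedy_alg_def vwork_def impl_work_def)

lemma cum_greedy: "i < length T \<Longrightarrow> cum (greedy_alg p T) i a x = integral {a..x} (Q.palloc i)"
  unfolding cum_def alloc_greedy by (rule rate_fun_LINT[OF Q.rate_fun_palloc])

lemma finished_greedy:
  assumes "i < length T"
  shows "arr (T ! i) + 4 * vkey p T i \<in>
    {x. arr (T ! i) \<le> x \<and> work T (greedy_alg p T) i \<le> cum (greedy_alg p T) i (arr (T ! i)) x}"
  using Q.prompt_completion[OF assms] Q.key_pos[OF assms]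
  by (simp add: work_greedy cum_greedy[OF assms])

lemma completion_greedy_le:
  assumes "i < length T"
  shows "completion T (greedy_alg p T) i \<le> arr (T ! i) + 4 * vkey p T i"
  unfolding completion_def
  by (rule cInf_lower[OF finished_greedy[OF assms]]) (auto intro: bdd_belowI[of _ "arr (T ! i)"])

lemma feasible_greedy: "feasible p T (greedy_alg p T)"
  unfolding feasible_def
proof (intro conjI allI impI)
  fix s show "(\<Sum>i<length T. alloc (greedy_alg p T) i s) \<le> real p"
    unfolding alloc_greedy by (rule Q.palloc_sum_le)
next
  fix i s assume i: "i < length T"
  note rf = Q.rate_fun_palloc[OF i]
  show "alloc (greedy_alg p T) i \<in> borel_measurable lborel"
    and "0 \<le> alloc (greedy_alg p T) i s"
    using rf by (auto simp: alloc_greedy rate_fun_def)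
  show "alloc (greedy_alg p T) i s = 0" if "s < arr (T ! i)"
    unfolding alloc_greedy using that Q.arv_le_rel[OF i] by (intro Q.palloc_early) simp
  show "alloc (greedy_alg p T) i s \<le> 1" if "\<not> choice (greedy_alg p T) i"
    using that rf by (auto simp: alloc_def rate_fun_def vcap_def choice_def greedy_alg_def)
  show "\<exists>x\<ge>arr (T ! i). work T (greedy_alg p T) i \<le> cum (greedy_alg p T) i (arr (T ! i)) x"
    using finished_greedy[OF i] by blast
  let ?X = "{x. arr (T ! i) \<le> x \<and> work T (greedy_alg p T) i \<le> cum (greedy_alg p T) i (arr (T ! i)) x}"
  assume "completion T (greedy_alg p T) i < s"
  moreover have "?X \<noteq> {}" using finished_greedy[OF i] by (rule ex_in_conv[THEN iffD1, OF exI])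
  \<comment> \<open>Any instant past the infimum has a finishing time before it, so the infimum need
    not be attained.\<close>
  ultimately obtain x where "x \<in> ?X" "x < s"
    unfolding completion_def by (elim cInf_lessD[THEN bexE, rotated])
  then show "alloc (greedy_alg p T) i s = 0"
    unfolding alloc_greedy using Q.palloc_done[OF i, of "arr (T ! i)" x s]
    by (simp add: work_greedy cum_greedy[OF i])
qed

lemma TRT_greedy_le: "TRT T (greedy_alg p T) \<le> 4 * (\<Sum>i<length T. dual p T i)"
proof -
  have "TRT T (greedy_alg p T) \<le> (\<Sum>i<length T. 4 * vkey p T i)"
    unfolding TRT_def using completion_greedy_le by (intro sum_mono) (auto simp: diff_le_eq add.commute)
  also have "\<dots> = 4 * (\<Sum>i<length T. dual p T i)"
    unfolding dual_sum[OF order_refl, symmetric] by (simp add: vkey_def sum_distrib_left)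
  finally show ?thesis .
qed

text \<open>Which tasks are released by \<open>t\<close> can be told from the arrivals up to
  \<open>t\<close>: later tasks finish virtually after \<open>t\<close>, predictions at most
  \<open>t\<close> are frozen, and the others only grow.\<close>

lemma vcomp_length_le_iff:
  assumes "k \<le> length T" "\<And>j. k \<le> j \<Longrightarrow> j < length T \<Longrightarrow> t < arr (T ! j)"
  shows "i < length T \<and> vcomp p T (length T) i \<le> t \<longleftrightarrow> i < k \<and> vcomp p T k i \<le> t"
proof (cases "i < k")
  case True
  then show ?thesis
    using vcomp_stable[OF assms(1) order_refl True assms(2)] vcomp_mono[OF assms(1) order_refl True] assms(1)
    by (auto intro: order_trans)
next
  case False
  then show ?thesis using assms(2)[of i] Q.arv_le_rel[of i] by fastforce
qed

end

text \<open>Implementations depend only on the tasks up to the one concerned. For allocations, the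
  two inputs have the same jobs released by \<open>t\<close>, with equal data, so
  \<open>palloc_causal\<close> applies.\<close>

lemma greedy_online:
  assumes p: "1 \<le> p"
  shows "online p (greedy_alg p)"
  unfolding online_def
proof (intro allI impI)
  fix T T' k t i
  assume "valid_tap p T \<and> valid_tap p T' \<and> k \<le> length T \<and> k \<le> length T' \<and> take k T = take k T'
        \<and> (\<forall>i. k \<le> i \<and> i < length T \<longrightarrow> t < arr (T ! i))
        \<and> (\<forall>i. k \<le> i \<and> i < length T' \<longrightarrow> t < arr (T' ! i))"
    and i: "i < k"
  then have v: "valid_tap p T" "valid_tap p T'" and k: "k \<le> length T" "k \<le> length T'"
    and tk: "take k T = take k T'"
    and late: "\<And>i. k \<le> i \<Longrightarrow> i < length T \<Longrightarrow> t < arr (T ! i)"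
      "\<And>i. k \<le> i \<Longrightarrow> i < length T' \<Longrightarrow> t < arr (T' ! i)"
    by auto
  interpret A: tap p T using p v(1) by unfold_locales
  interpret B: tap p T' using p v(2) by unfold_locales
  have vc: "vcomp p T k = vcomp p T' k" by (rule vcomp_take_cong[OF tk k])
  have vi: "vimpl p T i = vimpl p T' i" if "i < k" for i by (rule vimpl_take_cong[OF tk k that])
  have nth: "T ! i = T' ! i" if "i < k" for i using tk that by (metis nth_take)
  note iffA = A.vcomp_length_le_iff[OF k(1) late(1)] and iffB = B.vcomp_length_le_iff[OF k(2) late(2)]
  have "alloc (greedy_alg p T) i s = alloc (greedy_alg p T') i s" if "s \<le> t" for s
    unfolding alloc_def greedy_alg_def snd_conv
  proof (rule palloc_causal[where t = t])
    show "j < length T \<and> vcomp p T (length T) j \<le> t \<longleftrightarrow>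
        j < length T' \<and> vcomp p T' (length T') j \<le> t" for j
      using iffA[of j] iffB[of j] vc by simp
    fix j assume "j < length T" "vcomp p T (length T) j \<le> t"
    then have j: "j < k" "vcomp p T k j \<le> t" using iffA[of j] by auto
    have "vcomp p T (length T) j = vcomp p T k j"
      by (rule A.vcomp_stable[OF k(1) order_refl j(1) late(1) j(2)])
    moreover have "vcomp p T' (length T') j = vcomp p T' k j"
      using B.vcomp_stable[OF k(2) order_refl j(1) late(2)] j(2) vc by simp
    ultimately show "vcomp p T (length T) j = vcomp p T' (length T') j \<and> vkey p T j = vkey p T' j
        \<and> vwork p T j = vwork p T' j \<and> vcap p T j = vcap p T' j"
      using vc vi[OF j(1)] nth[OF j(1)] by (simp add: vkey_def vwork_def vcap_def)
  qed (use i k that in auto)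
  then show "(\<forall>s\<le>t. alloc (greedy_alg p T) i s = alloc (greedy_alg p T') i s) \<and>
      (0 < cum (greedy_alg p T) i (arr (T ! i)) t \<longrightarrow>
        choice (greedy_alg p T) i = choice (greedy_alg p T') i)"
    using vi[OF i] by (simp add: choice_def greedy_alg_def)
qed

lemma greedy_competitive:
  assumes "1 \<le> p" "valid_tap p T"
  shows "TRT T (greedy_alg p T) \<le> 13 * TRT_OPT p (scale_tap 8 T)"
proof -
  interpret A: tap p T using assms by unfold_locales
  have arrs: "map arr (scale_tap 8 T) = map arr T" by (simp add: scale_tap_def arr_def)
  have "valid_tap p (scale_tap 8 T)"
    using assms(2) unfolding valid_tap_def arrs by (auto simp: scale_tap_def sig_def par_def arr_def)
  then interpret B: tap p "scale_tap 8 T" using assms(1) by unfold_locales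
  have "TRT T (greedy_alg p T) / 13 \<le> TRT_OPT p (scale_tap 8 T)"
    unfolding TRT_OPT_def
  proof (rule cInf_greatest)
    \<comment> \<open>The infimum is meaningful only over a nonempty set; the scheduler itself, run
      on the scaled input, supplies a member.\<close>
    show "{TRT (scale_tap 8 T) S |S. feasible p (scale_tap 8 T) S} \<noteq> {}"
      using B.feasible_greedy by blast
    fix z assume "z \<in> {TRT (scale_tap 8 T) S |S. feasible p (scale_tap 8 T) S}"
    then show "TRT T (greedy_alg p T) / 13 \<le> z"
      using A.TRT_greedy_le A.dual_sum_le_TRT by force
  qed
  then show ?thesis by simp
qed

theorem theorem6p6:
  shows "\<exists>(c::real) (C::real) (p0::nat). 1 \<le> c \<and> 1 \<le> C \<and>
           (\<forall>p\<ge>p0. \<exists>ALG. online_scheduler p ALG \<and>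
              (\<forall>T. valid_tap p T \<longrightarrow> TRT T (ALG T) \<le> C * TRT_OPT p (scale_tap c T)))"
\<comment> \<open>The ratio 13 is the promptness factor 4 times the duality factor
  \<open>13 / 4\<close>; any \<open>p \<ge> 1\<close> will do.\<close>
proof (rule exI[of _ 8], rule exI[of _ 13], rule exI[of _ 1], intro conjI allI impI)
  fix p :: nat assume p: "1 \<le> p"
  show "\<exists>ALG. online_scheduler p ALG \<and>
      (\<forall>T. valid_tap p T \<longrightarrow> TRT T (ALG T) \<le> 13 * TRT_OPT p (scale_tap 8 T))"
    using greedy_online[OF p] greedy_competitive[OF p] tap.feasible_greedy tap.intro[OF p]
    by (auto simp: online_scheduler_def intro!: exI[of _ "greedy_alg p"])
qed simp_all

end
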